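(* Let $m\in\mathbb N$, and let $F:\mathbb Z_{\ge0}\to[0,1]$ satisfy the following: - $F$ is convex and log-concave; - $F(k)\to0$ as $k\to\infty$; - for all $k_1,k_2\in\mathbb Z_{\ge0}$, $$\Delta^{(3)}F(k_1)\,\Delta F(k_2)+\Delta F(k_1)\,\Delta^{(3)}F(k_2)\le 2\,\Delta^{(2)}F(k_1)\,\Delta^{(2)}F(k_2).$$ Let $$\Gamma:=1-\sum_{n=0}^\infty\frac{m^n}{(m+1)^{n+1}}F(n),$$ and suppose $$m\le\frac{-m\,\Delta F(0)-\Gamma}{\Gamma+(1-\Gamma)\,m\,\Delta F(0)}.$$ If there is an $(F,m)$-discrete OCS, then there is a $\Gamma$-competitive algorithm for edge-weighted online bipartite matching.
   Context: Edge-weighted online bipartite matching with free disposal: offline vertices $L$ are known in advance. Online vertices arrive one at a time, and on arrival of $j$ the weights $w_{ij}\ge0$ ($i\in L$) are revealed. Each $j$ must be irrevocably assigned to at most one offline vertex before the next arrival. Each offline vertex contributes the largest weight among online vertices assigned to it. A randomized algorithm is $\Gamma$-competitive if its expected value is at least $\Gamma$ times the optimum offline matching weight on every instance. Discrete derivative: $(\Delta F)(n)=F(n+1)-F(n)$, and $\Delta^{(\ell)}$ is $\Delta$ applied $\ell$ times. For $F$ on $\mathbb Z_{\ge0}$: - convex means $\Delta^{(2)}F(k)\ge0$ for all $k$; - log-concave means $F(k)^2\ge F(k-1)F(k+1)$ for all $k\ge1$ (equivalently, $F(k+1)/F(k)$ is nonincreasing). Fix a set of ground elements. An $m$-discrete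 OCS is an online randomized algorithm that at each time step $j=1,2,\dots$ receives a size-$m$ multiset $A_j$ of ground elements and irrevocably selects a single winner from $A_j$. A set of time steps is consecutive if it is $\{j_1,\dots,j_2\}$ for some $j_1<j_2$. $\mathrm{count}_i(S)$ is the total multiplicity of $i$ in the multisets $A_j$, $j\in S$. An $(F,m)$-discrete OCS is an $m$-discrete OCS such that, for any element $i$ and pairwise disjoint consecutive sets of time steps $S_1,\dots,S_k$, the probability that $i$ never wins at a time step in $S_1\cup\dots\cup S_k$ is at most $\prod_{\ell=1}^kF(\mathrm{count}_i(S_\ell))$. *)

theory Defs
  imports "HOL-Probability.Probability" "HOL-Library.Multiset"
begin

definition fdiff :: "(nat \<Rightarrow> real) \<Rightarrow> nat \<Rightarrow> real" where
  "fdiff F n = F (n + 1) - F n"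

definition convex_seq :: "(nat \<Rightarrow> real) \<Rightarrow> bool" where
  "convex_seq F \<longleftrightarrow> (\<forall>k. (fdiff ^^ 2) F k \<ge> 0)"

definition log_concave_seq :: "(nat \<Rightarrow> real) \<Rightarrow> bool" where
  "log_concave_seq F \<longleftrightarrow> (\<forall>k\<ge>1. (F k)\<^sup>2 \<ge> F (k - 1) * F (k + 1))"

text \<open>An online randomized algorithm draws each output from a distribution that may depend on
  the earlier inputs, the earlier outputs, and the current input (in this order), but not on later
  inputs. Inputs are fixed in advance (oblivious adversary). Private random memory would not
  enlarge the set of joint output laws: conditioning on the earlier outputs removes it.\<close>

type_synonym ('x, 'y) online_alg = "'x list \<Rightarrow> 'y list \<Rightarrow> 'x \<Rightarrow> 'y pmf"

primrec run_from :: "('x, 'y) online_alg \<Rightarrow> 'x list \<Rightarrow> 'y list \<Rightarrow> 'x list \<Rightarrow> 'y list pmf" where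
  "run_from alg xs ys [] = return_pmf ys"
| "run_from alg xs ys (z # zs) =
     bind_pmf (alg xs ys z) (\<lambda>y. run_from alg (xs @ [z]) (ys @ [y]) zs)"

definition run :: "('x, 'y) online_alg \<Rightarrow> 'x list \<Rightarrow> 'y list pmf" where
  "run alg zs = run_from alg [] [] zs"

text \<open>Time steps are list positions, hence numbered from 0.\<close>

definition OCS_input :: "'e set \<Rightarrow> nat \<Rightarrow> 'e multiset list \<Rightarrow> bool" where
  "OCS_input G m As \<longleftrightarrow> (\<forall>A\<in>set As. set_mset A \<subseteq> G \<and> size A = m)"

definition discrete_OCS :: "'e set \<Rightarrow> nat \<Rightarrow> ('e multiset, 'e) online_alg \<Rightarrow> bool" where
  "discrete_OCS G m alg \<longleftrightarrow>
     (\<forall>As. OCS_input G m As \<longrightarrow>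
       (\<forall>ws\<in>set_pmf (run alg As). \<forall>j<length As. ws ! j \<in># As ! j))"

definition consecutive :: "nat set \<Rightarrow> bool" where
  "consecutive S \<longleftrightarrow> (\<exists>j1 j2. j1 < j2 \<and> S = {j1..j2})"

definition count_in :: "'e multiset list \<Rightarrow> 'e \<Rightarrow> nat set \<Rightarrow> nat" where
  "count_in As i S = (\<Sum>j\<in>S. count (As ! j) i)"

definition F_discrete_OCS ::
    "'e set \<Rightarrow> (nat \<Rightarrow> real) \<Rightarrow> nat \<Rightarrow> ('e multiset, 'e) online_alg \<Rightarrow> bool" where
  "F_discrete_OCS G F m alg \<longleftrightarrow>
     discrete_OCS G m alg \<and>
     (\<forall>As. OCS_input G m As \<longrightarrow>
       (\<forall>i\<in>G. \<forall>k. \<forall>S :: nat \<Rightarrow> nat set.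
          (\<forall>l<k. consecutive (S l) \<and> S l \<subseteq> {..<length As}) \<and> disjoint_family_on S {..<k} \<longrightarrow>
          measure_pmf.prob (run alg As) {ws. \<forall>j\<in>(\<Union>l<k. S l). ws ! j \<noteq> i}
            \<le> (\<Prod>l<k. F (count_in As i (S l)))))"

text \<open>Each online vertex is represented by its weight function, so position \<open>j\<close> of the
  list \<open>ws\<close> holds the weights of the edges at the \<open>j\<close>-th arrival; only the weights on the
  offline vertices \<open>L\<close> matter. The output \<open>None\<close> leaves the online vertex unassigned.\<close>

definition matching_instance :: "'v set \<Rightarrow> ('v \<Rightarrow> real) list \<Rightarrow> bool" where
  "matching_instance L ws \<longleftrightarrow> finite L \<and> (\<forall>w\<in>set ws. \<forall>i\<in>L. 0 \<le> w i)"

type_synonym 'v matching_alg = "'v set \<Rightarrow> ('v \<Rightarrow> real, 'v option) online_alg"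

definition valid_matching_alg :: "'v matching_alg \<Rightarrow> bool" where
  "valid_matching_alg alg \<longleftrightarrow>
     (\<forall>L ws. matching_instance L ws \<longrightarrow>
       (\<forall>as\<in>set_pmf (run (alg L) ws). set as \<subseteq> insert None (Some ` L)))"

definition free_disposal_value :: "'v set \<Rightarrow> ('v \<Rightarrow> real) list \<Rightarrow> 'v option list \<Rightarrow> real" where
  "free_disposal_value L ws as =
     (\<Sum>i\<in>L. Max (insert 0 {(ws ! j) i | j. j < length ws \<and> as ! j = Some i}))"

definition is_matching :: "'v set \<Rightarrow> nat \<Rightarrow> ('v \<times> nat) set \<Rightarrow> bool" where
  "is_matching L n M \<longleftrightarrow> M \<subseteq> L \<times> {..<n} \<and> inj_on fst M \<and> inj_on snd M"

definition opt_value :: "'v set \<Rightarrow> ('v \<Rightarrow> real) list \<Rightarrow> real" where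
  "opt_value L ws =
     Max {(\<Sum>(i, j)\<in>M. (ws ! j) i) | M. is_matching L (length ws) M}"

definition competitive :: "real \<Rightarrow> 'v matching_alg \<Rightarrow> bool" where
  "competitive c alg \<longleftrightarrow>
     (\<forall>L ws. matching_instance L ws \<longrightarrow>
       measure_pmf.expectation (run (alg L) ws) (free_disposal_value L ws) \<ge> c * opt_value L ws)"

end

(* The m elements requested at an arrival are chosen one at a time, greedily and
   deterministically. At each weight level v the bound of the OCS depends on a pair (p, n): p is
   the product of F over the finished blocks of arrivals of weight at least v, and n is the count
   in the current block. A primal-dual argument assigns to this state the dual value
   Gamma (1 - p) + p a(n), where a(n) = Gamma + T(n) - F(n) and T(n) is the mean of F(n + N) for a
   geometric variable N. An arrival that extends the block raises the dual by just the amount that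
   keeps dual plus scaled gain equal to Gamma; log-concavity of F makes closing a block raise the
   dual, and the bound on m, propagated from n = 1 to all n by the log-concavity of -(Delta F)
   (the third-difference condition for k1 = k2), makes this raise affordable. *)

theory Submission
  imports Defs
begin

section \<open>The potential\<close>

text \<open>The factor \<open>m\<close> on the gain comes from counting picks: each of the
  \<open>m\<close> picks of an arrival gains at least as much as offering any fixed vertex
  \<open>i\<close> would, so \<open>m\<close> inequalities
  \<open>\<Gamma> * w i \<le> dual + m * gain\<close> add up, after division by \<open>m\<close>, to
  the dual constraint of the edge, with the total gain of the arrival as dual variable of the online
  vertex. With this factor, exact balance on extending a block is a linear recurrence for
  \<open>a\<close> that expands by (m + 1) / m. Its only bounded solution is the mean over a
  geometric variable with ratio m / (m + 1), and \<open>a 0 = 0\<close> then is the formula for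
  \<Gamma>. Two obstacles lie outside this calculation: F(0) = 1 has to be extracted from the OCS
  itself, and blocks may be single arrivals, which \<open>consecutive\<close> excludes, so time is
  doubled by dummy steps.\<close>

lemma log_concave_adjacent:
  fixes s :: "nat \<Rightarrow> real"
  assumes nonneg: "\<And>n. 0 \<le> s n" and dec: "decseq s"
    and lc: "\<And>n. s n * s (n + 2) \<le> (s (Suc n))\<^sup>2"
  shows "s (Suc (n + k)) * s k \<le> s (n + k) * s (Suc k)"
proof (induction n)
  case (Suc n)
  show ?case
  proof (cases "s (n + k) = 0")
    \<comment> \<open>Log-concavity alone says nothing past a zero; being decreasing keeps the
      sequence at zero from there on.\<close>
    case True
    then have "s (Suc (Suc (n + k))) = 0"
      using decseqD[OF dec, of "n + k" "Suc (Suc (n + k))"] nonneg[of "Suc (Suc (n + k))"] by simp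
    then show ?thesis using nonneg by simp
  next
    case False
    then have pos: "0 < s (n + k)" using nonneg[of "n + k"] by simp
    have "s (n + k) * (s (Suc (Suc (n + k))) * s k) = (s (n + k) * s (n + k + 2)) * s k" by simp
    also have "\<dots> \<le> (s (Suc (n + k)))\<^sup>2 * s k"
      using lc[of "n + k"] nonneg by (intro mult_right_mono) auto
    also have "\<dots> = s (Suc (n + k)) * (s (Suc (n + k)) * s k)" by (simp add: power2_eq_square)
    also have "\<dots> \<le> s (Suc (n + k)) * (s (n + k) * s (Suc k))"
      using Suc nonneg by (intro mult_left_mono) auto
    also have "\<dots> = s (n + k) * (s (Suc (n + k)) * s (Suc k))" by simp
    finally show ?thesis using pos by simp
  qed
qed simp

text \<open>\<open>s (n + k) / s n\<close> is a product of \<open>k\<close> successive ratios, each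
  at most the corresponding ratio in \<open>s k / s 0\<close>. It is applied both to
  \<open>F\<close> and to its decrements.\<close>

lemma log_concave_submult:
  fixes s :: "nat \<Rightarrow> real"
  assumes nonneg: "\<And>n. 0 \<le> s n" and dec: "decseq s"
    and lc: "\<And>n. s n * s (n + 2) \<le> (s (Suc n))\<^sup>2"
  shows "s (n + k) * s 0 \<le> s n * s k"
proof (induction k)
  case (Suc k)
  show ?case
  proof (cases "s k = 0")
    case True
    then have "s (Suc (n + k)) = 0"
      using decseqD[OF dec, of k "Suc (n + k)"] nonneg[of "Suc (n + k)"] by simp
    then show ?thesis using nonneg by simp
  next
    case False
    then have pos: "0 < s k" using nonneg[of k] by simp
    have "s k * (s (Suc (n + k)) * s 0) = (s (Suc (n + k)) * s k) * s 0" by simp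
    also have "\<dots> \<le> (s (n + k) * s (Suc k)) * s 0"
      using log_concave_adjacent[OF assms] nonneg by (intro mult_right_mono) auto
    also have "\<dots> = (s (n + k) * s 0) * s (Suc k)" by simp
    also have "\<dots> \<le> (s n * s k) * s (Suc k)"
      using Suc nonneg by (intro mult_right_mono) auto
    also have "\<dots> = s k * (s n * s (Suc k))" by simp
    finally show ?thesis using pos by simp
  qed
qed simp

text \<open>By convexity a single strict increase persists, which keeps \<open>F\<close> above a
  positive value and contradicts the limit 0.\<close>

lemma convex_tendsto_0_decreasing:
  fixes F :: "nat \<Rightarrow> real"
  assumes nonneg: "\<And>n. 0 \<le> F n" and lim: "F \<longlonglongrightarrow> 0"
    and convex: "decseq (\<lambda>n. F n - F (Suc n))"
  shows "F (Suc n) \<le> F n"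
proof (rule ccontr)
  assume "\<not> F (Suc n) \<le> F n"
  then have up: "F n < F (Suc n)" by simp
  have "F (Suc n) \<le> F (Suc n + k)" for k
  proof (induction k)
    case (Suc k)
    show ?case using Suc decseqD[OF convex, of n "Suc n + k"] up by simp
  qed simp
  then have "\<forall>k\<ge>Suc n. F (Suc n) \<le> F k" by (metis le_Suc_ex)
  then have "F (Suc n) \<le> 0"
    by (intro LIMSEQ_le_const[OF lim]) auto
  then show False using up nonneg[of n] by simp
qed

text \<open>At a fixed weight level an offline vertex is in state \<open>(p, n)\<close>: \<open>p\<close> is the product of
  \<open>F\<close> over its finished blocks and \<open>n\<close> the count in the current block. The dual value of this
  state is \<open>\<Gamma> * (1 - p) + p * a n\<close>. The assumption \<open>balance\<close> handles an arrival that extends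
  the block, \<open>closing_gain\<close> and \<open>closing_cost\<close> one that ends it.\<close>

locale block_potential =
  fixes F a :: "nat \<Rightarrow> real" and m :: nat and \<Gamma> :: real
  assumes m_pos: "0 < m" and Gamma_nonneg: "0 \<le> \<Gamma>"
    and F_0: "F 0 = 1" and F_nonneg: "0 \<le> F n" and F_le_1: "F n \<le> 1"
    and a_0: "a 0 = 0" and a_mono: "a n \<le> a (Suc n)"
    and balance: "a n + real m * (F n - F (Suc n)) - real m * (a (Suc n) - a n) = \<Gamma>"
    and closing_gain: "a n \<le> \<Gamma> * (1 - F n)"
    and closing_cost: "real m * (\<Gamma> * (1 - F n) - a n) \<le> a n"

text \<open>Monotonicity of \<open>a\<close> comes from convexity, \<open>closing_gain\<close> from
  log-concavity of \<open>F\<close>, and \<open>closing_cost\<close> from \<open>m_bound\<close>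
  together with log-concavity of the decrements \<open>g\<close>.\<close>

lemma block_potential_exists:
  fixes m :: nat and F :: "nat \<Rightarrow> real" and \<Gamma> :: real
  assumes m_pos: "0 < m" and F_0: "F 0 = 1"
    and F_range: "\<And>k. F k \<in> {0..1}"
    and F_convex: "convex_seq F"
    and F_log_concave: "log_concave_seq F"
    and F_limit: "F \<longlonglongrightarrow> 0"
    and F_third: "\<And>k. (fdiff ^^ 3) F k * fdiff F k \<le> ((fdiff ^^ 2) F k)\<^sup>2"
    and Gamma_eq: "\<Gamma> = 1 - (\<Sum>n. real m ^ n / (real m + 1) ^ (n + 1) * F n)"
    and m_bound: "real m \<le> (- real m * fdiff F 0 - \<Gamma>) / (\<Gamma> + (1 - \<Gamma>) * real m * fdiff F 0)"
  obtains a where "block_potential F a m \<Gamma>"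
proof -
  define g where "g n = F n - F (Suc n)" for n
  define r where "r = real m / (real m + 1)"
  define c where "c k = (1 - r) * r ^ k" for k
  define T where "T n = (\<Sum>k. c k * F (n + k))" for n
  define a where "a n = \<Gamma> + T n - F n" for n
  have F_nonneg: "0 \<le> F n" and F_le_1: "F n \<le> 1" for n using F_range[of n] by auto
  have r: "0 < r" "r < 1" using m_pos by (auto simp: r_def)
  have c_nonneg: "0 \<le> c k" for k using r by (simp add: c_def)
  have c_sums: "c sums 1"
    using sums_mult[OF geometric_sums[of r], of "1 - r"] r by (simp add: c_def[abs_def])
  have summable_c: "summable (\<lambda>k. c k * f k)" if "\<And>k. \<bar>f k\<bar> \<le> 1" for f :: "nat \<Rightarrow> real"
    by (rule summable_comparison_test'[OF sums_summable[OF c_sums], of 0])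
       (use that c_nonneg in \<open>auto simp: abs_mult intro: mult_left_le\<close>)
  have sF: "summable (\<lambda>k. c k * F (n + k))" for n
    by (rule summable_c) (use F_nonneg F_le_1 in auto)
  have c_eq: "real m ^ n / (real m + 1) ^ (n + 1) = c n" for n
    using m_pos by (simp add: c_def r_def field_simps power_divide)
  have Gamma_T: "\<Gamma> = 1 - T 0" unfolding Gamma_eq T_def c_eq by simp
  have "T 0 \<le> (\<Sum>k. c k)" unfolding T_def
    by (rule suminf_le[OF _ sF sums_summable[OF c_sums]])
       (use c_nonneg F_le_1 in \<open>auto intro: mult_left_le\<close>)
  then have Gamma_nonneg: "0 \<le> \<Gamma>" using Gamma_T sums_unique[OF c_sums] by simp

  have g_dec: "decseq g"
  proof (rule decseq_SucI)
    show "g (Suc n) \<le> g n" for n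
      using F_convex[unfolded convex_seq_def, rule_format, of n]
      by (simp add: fdiff_def g_def numeral_2_eq_2)
  qed
  have F_Suc: "F (Suc n) \<le> F n" for n
    using convex_tendsto_0_decreasing[OF F_nonneg F_limit] g_dec by (simp add: g_def[abs_def])
  have F_dec: "decseq F" by (intro decseq_SucI F_Suc)
  have g_nonneg: "0 \<le> g n" and g_le_1: "g n \<le> 1" for n
    using F_Suc[of n] F_nonneg[of "Suc n"] F_le_1[of n] by (auto simp: g_def)
  have F_sub: "F (n + k) \<le> F n * F k" for n k
  proof -
    have "F j * F (j + 2) \<le> (F (Suc j))\<^sup>2" for j
      using F_log_concave[unfolded log_concave_seq_def, rule_format, of "Suc j"] by simp
    from log_concave_submult[OF F_nonneg F_dec this, of n k] show ?thesis using F_0 by simp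
  qed
  \<comment> \<open>Written out in \<open>g\<close>, the third-difference condition loses its common
    terms and becomes log-concavity of \<open>g\<close>.\<close>
  have g_sub: "g (n + k) * g 0 \<le> g n * g k" for n k
  proof (rule log_concave_submult[OF g_nonneg g_dec])
    show "g j * g (j + 2) \<le> (g (Suc j))\<^sup>2" for j
      using F_third[of j]
      by (simp add: g_def fdiff_def numeral_2_eq_2 numeral_3_eq_3 power2_eq_square algebra_simps)
  qed

  have T_Suc: "T n = (1 - r) * F n + r * T (Suc n)" for n
  proof -
    have "T n = c 0 * F n + (\<Sum>k. c (Suc k) * F (n + Suc k))"
      unfolding T_def using suminf_split_head[OF sF[of n]] by simp
    also have "(\<Sum>k. c (Suc k) * F (n + Suc k)) = (\<Sum>k. r * (c k * F (Suc n + k)))"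
      by (simp add: c_def mult.assoc mult.left_commute)
    also have "\<dots> = r * T (Suc n)" unfolding T_def by (rule suminf_mult[OF sF])
    finally show ?thesis by (simp add: c_def)
  qed
  have step: "a n + real m * (F n - F (Suc n)) - real m * (a (Suc n) - a n) = \<Gamma>" for n
  proof -
    have "(real m + 1) * T n
        = (real m + 1) * (1 - r) * F n + (real m + 1) * r * T (Suc n)"
      unfolding T_Suc[of n] by (simp add: algebra_simps)
    also have "(real m + 1) * r = real m" by (simp add: r_def)
    also have "(real m + 1) * (1 - r) = 1" by (simp add: r_def field_simps)
    finally have "(real m + 1) * T n = F n + real m * T (Suc n)" by simp
    then show ?thesis by (simp add: a_def algebra_simps)
  qed
  have a_0: "a 0 = 0" using Gamma_T F_0 by (simp add: a_def)
  define b where "b n = a (Suc n) - a n" for n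
  have sg: "summable (\<lambda>k. c k * g (n + k))" for n
    by (rule summable_c) (use g_nonneg g_le_1 in auto)
  have b_eq: "b n = g n - (\<Sum>k. c k * g (n + k))" for n
  proof -
    have "(\<Sum>k. c k * g (n + k)) = T n - T (Suc n)"
      unfolding T_def suminf_diff[OF sF sF] by (simp add: g_def algebra_simps)
    then show ?thesis by (simp add: b_def a_def g_def)
  qed
  have b_nonneg: "0 \<le> b n" for n
  proof -
    have "(\<Sum>k. c k * g (n + k)) \<le> (\<Sum>k. g n * c k)"
      by (rule suminf_le[OF _ sg summable_mult[OF sums_summable[OF c_sums]]])
         (use c_nonneg decseqD[OF g_dec] in \<open>auto simp: mult.commute intro: mult_left_mono\<close>)
    also have "\<dots> = g n" using sums_unique[OF sums_mult[OF c_sums, of "g n"]] by simp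
    finally show ?thesis by (simp add: b_eq)
  qed
  \<comment> \<open>Averaging \<open>F_sub\<close> over \<open>k\<close> gives
    \<open>T n \<le> F n * T 0\<close>, and \<open>T 0\<close> is 1 - \<Gamma>.\<close>
  have closing_gain: "a n \<le> \<Gamma> * (1 - F n)" for n
  proof -
    have "T n \<le> (\<Sum>k. F n * (c k * F (0 + k)))" unfolding T_def
    proof (rule suminf_le[OF _ sF summable_mult[OF sF]])
      fix k
      have "c k * F (n + k) \<le> c k * (F n * F k)" by (rule mult_left_mono[OF F_sub c_nonneg])
      then show "c k * F (n + k) \<le> F n * (c k * F (0 + k))" by (simp add: mult_ac)
    qed
    also have "\<dots> = F n * T 0" unfolding T_def by (rule suminf_mult[OF sF])
    finally show ?thesis by (simp add: a_def Gamma_T algebra_simps)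
  qed

  have g0_pos: "0 < g 0"
  proof (rule ccontr)
    assume "\<not> 0 < g 0"
    then have "g n = 0" for n
      using decseqD[OF g_dec, of 0 n] g_nonneg[of n] by simp
    then have "F n = 1" for n by (induction n) (auto simp: g_def F_0)
    then have "F = (\<lambda>_. 1)" by auto
    then show False using F_limit LIMSEQ_unique[of "\<lambda>_. 1::real" 1 0] by auto
  qed
  define d where "d = real m * g 0"
  have d_pos: "0 < d" using g0_pos m_pos by (simp add: d_def)
  have md: "real m * fdiff F 0 = - d" by (simp add: d_def g_def fdiff_def algebra_simps)
  have mb: "real m \<le> (d - \<Gamma>) / (\<Gamma> - (1 - \<Gamma>) * d)" (is "_ \<le> _ / ?den")
    using m_bound md by (simp add: mult.assoc)
  \<comment> \<open>Clearing the denominator needs its sign. Division by zero yields 0, which is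
    below \<open>m\<close>; a negative denominator would force d < \<Gamma> < (1 - \<Gamma>) d \<le>
    d.\<close>
  have den_pos: "0 < ?den"
  proof (rule ccontr)
    assume "\<not> 0 < ?den"
    then consider "?den = 0" | "?den < 0" by linarith
    then show False
    proof cases
      case 1
      show False using mb m_pos unfolding 1 by simp
    next
      case 2
      have "0 < (d - \<Gamma>) / ?den" using mb m_pos by linarith
      then have "d - \<Gamma> < 0" using 2 by (simp add: zero_less_divide_iff)
      moreover have "\<Gamma> < (1 - \<Gamma>) * d" using 2 by simp
      moreover have "(1 - \<Gamma>) * d \<le> 1 * d" using Gamma_nonneg d_pos by (intro mult_right_mono) auto
      ultimately show False by simp
    qed
  qed
  have "real m * ?den \<le> d - \<Gamma>" using mb den_pos by (simp add: pos_le_divide_eq)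
  then have b0: "real m * (\<Gamma> * d) \<le> (real m + 1) * (d - \<Gamma>)" by (simp add: algebra_simps)
  \<comment> \<open>This identifies the numerator of \<open>m_bound\<close>; the hypothesis thereby
    turns into the case n = 0 of \<open>b_lower\<close>.\<close>
  have mb0: "real m * b 0 = d - \<Gamma>"
    using step[of 0] a_0 by (simp add: b_def d_def g_def algebra_simps)
  have "real m * (real m * \<Gamma> * g 0) = real m * (\<Gamma> * d)" by (simp add: d_def)
  also note b0
  also have "(real m + 1) * (d - \<Gamma>) = real m * ((real m + 1) * b 0)"
    unfolding mb0[symmetric] by simp
  finally have "real m * (real m * \<Gamma> * g 0) \<le> real m * ((real m + 1) * b 0)" .
  then have b0': "real m * \<Gamma> * g 0 \<le> (real m + 1) * b 0" using m_pos by simp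
  \<comment> \<open>By \<open>b_eq\<close>, \<open>b n / g n\<close> is one minus the mean of
    \<open>g (n + k) / g n\<close>, and \<open>g_sub\<close> makes that mean largest at n =
    0.\<close>
  have b_ratio: "b 0 * g n \<le> b n * g 0" for n
  proof -
    have "(\<Sum>k. g 0 * (c k * g (n + k))) \<le> (\<Sum>k. g n * (c k * g (0 + k)))"
    proof (rule suminf_le[OF _ summable_mult[OF sg] summable_mult[OF sg]])
      fix k
      have "c k * (g (n + k) * g 0) \<le> c k * (g n * g k)" by (rule mult_left_mono[OF g_sub c_nonneg])
      then show "g 0 * (c k * g (n + k)) \<le> g n * (c k * g (0 + k))" by (simp add: mult_ac)
    qed
    then have "g 0 * (\<Sum>k. c k * g (n + k)) \<le> g n * (\<Sum>k. c k * g (0 + k))"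
      using suminf_mult[OF sg[of n], of "g 0"] suminf_mult[OF sg[of 0], of "g n"] by simp
    then show ?thesis unfolding b_eq[of n] b_eq[of 0] by (simp add: algebra_simps)
  qed
  have b_lower: "real m * \<Gamma> * g n \<le> (real m + 1) * b n" for n
  proof -
    have "g 0 * (real m * \<Gamma> * g n) = (real m * \<Gamma> * g 0) * g n" by simp
    also have "\<dots> \<le> ((real m + 1) * b 0) * g n" using b0' g_nonneg by (intro mult_right_mono) auto
    also have "\<dots> = (real m + 1) * (b 0 * g n)" by simp
    also have "\<dots> \<le> (real m + 1) * (b n * g 0)" using b_ratio by (intro mult_left_mono) auto
    also have "\<dots> = g 0 * ((real m + 1) * b n)" by simp
    finally show ?thesis using g0_pos by simp
  qed
  \<comment> \<open>Summing \<open>b_lower\<close> telescopes: \<open>g\<close> adds up to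
    \<open>1 - F n\<close> and \<open>b\<close> to \<open>a n\<close>.\<close>
  have closing: "real m * \<Gamma> * (1 - F n) \<le> (real m + 1) * a n" for n
  proof (induction n)
    case (Suc n)
    then show ?case using b_lower[of n] by (simp add: b_def g_def algebra_simps)
  qed (simp add: F_0 a_0)
  have "block_potential F a m \<Gamma>"
  proof
    show "a n \<le> a (Suc n)" for n using b_nonneg[of n] by (simp add: b_def)
    show "real m * (\<Gamma> * (1 - F n) - a n) \<le> a n" for n
      using closing[of n] by (simp add: algebra_simps)
  qed (use m_pos Gamma_nonneg F_0 F_nonneg F_le_1 a_0 step closing_gain in auto)
  then show thesis by (rule that)
qed

section \<open>Weight levels of an offline vertex\<close>

text \<open>The list holds the weights at which an offline vertex was offered, latest first.\<close>

primrec level_state :: "(nat \<Rightarrow> real) \<Rightarrow> real \<Rightarrow> real list \<Rightarrow> real \<times> nat" where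
  "level_state F v [] = (1, 0)"
| "level_state F v (W # h) =
     (case level_state F v h of (p, n) \<Rightarrow> if v \<le> W then (p, Suc n) else (p * F n, 0))"

text \<open>By the layer-cake formula a nonnegative weight is the integral over v > 0 of the
  indicator that it is at least \<open>v\<close>, so bounds on values can be proved one level at a
  time.\<close>

definition level_integral ::
    "(nat \<Rightarrow> real) \<Rightarrow> (real \<times> nat \<Rightarrow> real) \<Rightarrow> real list \<Rightarrow> real" where
  "level_integral F \<Phi> h = (LINT v:{0<..}|lborel. \<Phi> (level_state F v h))"

lemma set_integrable_below:
  fixes c W :: real
  shows "set_integrable lborel {0<..} (\<lambda>v. (c * indicator {..W} v :: real))"
proof -
  have "(\<lambda>v. indicator {0<..} v *\<^sub>R (c * indicator {..W} v :: real)) = (\<lambda>v. indicator {0<..W} v * c)"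
    by (auto simp: fun_eq_iff indicator_def)
  moreover have "integrable lborel (\<lambda>v. indicator {0<..W} v * c)"
    by (intro integrable_mult_left integrable_real_indicator emeasure_bounded_finite) auto
  ultimately show ?thesis unfolding set_integrable_def by simp
qed

lemma set_integral_below:
  fixes c W :: real
  assumes "0 \<le> W"
  shows "(LINT v:{0<..}|lborel. c * indicator {..W} v) = c * W"
proof -
  have "(\<lambda>v. indicator {0<..} v *\<^sub>R (c * indicator {..W} v :: real)) = (\<lambda>v. indicator {0<..W} v * c)"
    by (auto simp: fun_eq_iff indicator_def)
  then show ?thesis using assms unfolding set_lebesgue_integral_def by simp
qed

context
  fixes F :: "nat \<Rightarrow> real"
  assumes F_0: "F 0 = 1"
begin

text \<open>Above all weights in \<open>h\<close> the state is (1, 0), because F(0) = 1, so the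
  integrand vanishes outside a bounded set. \<open>\<Phi>\<close> is generalised in the induction
  because each offer composes it with a state update.\<close>

lemma level_integrable:
  fixes \<Phi> :: "real \<times> nat \<Rightarrow> real"
  assumes "\<Phi> (1, 0) = 0"
  shows "set_integrable lborel {0<..} (\<lambda>v. \<Phi> (level_state F v h))"
  using assms
proof (induction h arbitrary: \<Phi>)
  case Nil
  then show ?case by (simp add: set_integrable_def)
next
  case (Cons W h)
  \<comment> \<open>Subtracting this value makes \<open>\<Phi>1\<close> vanish at (1, 0), as the
    induction hypothesis demands; the constant is added back only on the bounded range up to
    \<open>W\<close>.\<close>
  define c where "c = \<Phi> (1, 1)"
  define \<Phi>1 where "\<Phi>1 = (\<lambda>(p, n). \<Phi> (p, Suc n) - c)"
  define \<Phi>2 where "\<Phi>2 = (\<lambda>(p, n). \<Phi> (p * F n, 0))"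
  have 1: "set_integrable lborel {0<..} (\<lambda>v. \<Phi>1 (level_state F v h))"
    by (rule Cons.IH) (simp add: \<Phi>1_def c_def)
  have 2: "set_integrable lborel {0<..} (\<lambda>v. \<Phi>2 (level_state F v h))"
    by (rule Cons.IH) (simp add: \<Phi>2_def Cons.prems F_0)
  have 3: "set_integrable lborel {0<..} (\<lambda>v. indicator {..W} v * \<Phi>1 (level_state F v h))"
    using integrable_mult_indicator[OF _ 1[unfolded set_integrable_def], of "{..W}"]
    by (simp add: set_integrable_def mult_ac)
  have 4: "set_integrable lborel {0<..} (\<lambda>v. indicator {W<..} v * \<Phi>2 (level_state F v h))"
    using integrable_mult_indicator[OF _ 2[unfolded set_integrable_def], of "{W<..}"]
    by (simp add: set_integrable_def mult_ac)
  have "(\<lambda>v. \<Phi> (level_state F v (W # h))) =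
      (\<lambda>v. c * indicator {..W} v + indicator {..W} v * \<Phi>1 (level_state F v h)
         + indicator {W<..} v * \<Phi>2 (level_state F v h))"
    by (auto simp: fun_eq_iff \<Phi>1_def \<Phi>2_def split: prod.splits)
  then show ?case
    using set_integral_add(1)[OF set_integral_add(1)[OF set_integrable_below[of c W] 3] 4] by simp
qed

lemma level_integral_mono:
  assumes "\<Phi> (1, 0) = 0" "\<Psi> (1, 0) = 0"
    and "\<And>v. 0 < v \<Longrightarrow> \<Phi> (level_state F v h) \<le> \<Psi> (level_state F v h')"
  shows "level_integral F \<Phi> h \<le> level_integral F \<Psi> h'"
  unfolding level_integral_def
  by (rule set_integral_mono) (use assms level_integrable in auto)

end

section \<open>Primal and dual values of one offline vertex\<close>

context block_potential
begin

lemmas level_integrable' = level_integrable[where F = F, OF F_0]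
lemmas level_integral_mono' = level_integral_mono[where F = F, OF F_0]

abbreviation win_bound :: "real \<times> nat \<Rightarrow> real" where
  "win_bound \<equiv> \<lambda>(p, n). 1 - p * F n"

abbreviation dual_density :: "real \<times> nat \<Rightarrow> real" where
  "dual_density \<equiv> \<lambda>(p, n). \<Gamma> * (1 - p) + p * a n"

text \<open>The OCS bounds the probability that no offer of weight at least \<open>v\<close> is won
  by \<open>p * F n\<close>, so this integral is a lower bound for the expected contribution of the
  vertex.\<close>

definition primal :: "real list \<Rightarrow> real" where
  "primal = level_integral F win_bound"

definition dual :: "real list \<Rightarrow> real" where
  "dual = level_integral F dual_density"

text \<open>What remains of the primal increase after paying for the dual increase of the offline
  vertex; it is credited to the online vertex.\<close>

definition gain :: "real list \<Rightarrow> real \<Rightarrow> real" where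
  "gain h W = (primal (W # h) - primal h) - (dual (W # h) - dual h)"

lemma level_state_fst: "fst (level_state F v h) \<in> {0..1}"
proof (induction h)
  case (Cons W h)
  then show ?case
    using F_nonneg F_le_1 by (auto simp: mult_le_one split: prod.splits)
qed simp

lemma a_nonneg: "0 \<le> a n"
  by (induction n) (use a_0 a_mono order_trans in auto)

lemma dual_nonneg: "0 \<le> dual h"
proof -
  have "level_integral F (\<lambda>_. 0) h \<le> dual h" unfolding dual_def
  proof (rule level_integral_mono')
    show "0 \<le> dual_density (level_state F v h)" for v
      using level_state_fst[of v h] a_nonneg Gamma_nonneg
      by (auto simp: split_beta)
  qed (auto simp: a_0)
  then show ?thesis by (simp add: level_integral_def)
qed

text \<open>Levels up to \<open>W\<close> rise by \<open>a_mono\<close>, higher ones by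
  \<open>closing_gain\<close>. Monotonicity lets an edge constraint obtained at an arrival be
  restated with the final dual.\<close>

lemma dual_Cons_mono: "dual h \<le> dual (W # h)"
  unfolding dual_def
proof (rule level_integral_mono')
  fix v
  obtain p n where s: "level_state F v h = (p, n)" by fastforce
  have p: "0 \<le> p" using level_state_fst[of v h] by (simp add: s)
  show "dual_density (level_state F v h) \<le> dual_density (level_state F v (W # h))"
    using mult_left_mono[OF a_mono[of n] p] mult_left_mono[OF closing_gain[of n] p]
    by (simp add: s a_0 algebra_simps)
qed (auto simp: a_0)

text \<open>The left side is the integral of \<Gamma> over the levels up to \<open>W\<close>. There
  the integrands agree by \<open>balance\<close>; above \<open>W\<close> the right one only has to
  be nonnegative.\<close>

lemma dual_gain_covers:
  assumes "0 \<le> W"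
  shows "\<Gamma> * W \<le> dual h + real m * gain h W"
proof -
  have ints: "set_integrable lborel {0<..} (\<lambda>v. win_bound (level_state F v h'))"
    "set_integrable lborel {0<..} (\<lambda>v. dual_density (level_state F v h'))" for h'
    by (rule level_integrable', simp add: F_0 a_0)+
  let ?f = "\<lambda>v. dual_density (level_state F v h) + real m *
     ((win_bound (level_state F v (W # h)) - win_bound (level_state F v h))
       - (dual_density (level_state F v (W # h)) - dual_density (level_state F v h)))"
  have f: "set_integrable lborel {0<..} ?f"
    by (intro set_integral_add set_integral_diff set_integrable_mult_right ints)
  have "\<Gamma> * W = (LINT v:{0<..}|lborel. \<Gamma> * indicator {..W} v)"
    by (rule set_integral_below[OF assms, symmetric])
  also have "\<dots> \<le> (LINT v:{0<..}|lborel. ?f v)"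
  proof (rule set_integral_mono[OF set_integrable_below f])
    fix v
    obtain p n where s: "level_state F v h = (p, n)" by fastforce
    have p: "0 \<le> p" "p \<le> 1" using level_state_fst[of v h] by (auto simp: s)
    show "\<Gamma> * indicator {..W} v \<le> ?f v"
    proof (cases "v \<le> W")
      case True
      have "?f v = \<Gamma> * (1 - p)
          + p * (a n + real m * (F n - F (Suc n)) - real m * (a (Suc n) - a n))"
        using True by (simp add: s algebra_simps)
      also have "\<dots> = \<Gamma>" unfolding balance by (simp add: algebra_simps)
      finally show ?thesis using True by simp
    next
      case False
      \<comment> \<open>Closing a block leaves \<open>win_bound\<close> unchanged, so only the rise
        of the dual has to be paid.\<close>
      have "?f v = \<Gamma> * (1 - p) + p * (a n - real m * (\<Gamma> * (1 - F n) - a n))"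
        using False by (simp add: s a_0 F_0 algebra_simps)
      moreover have "0 \<le> \<Gamma> * (1 - p)" using Gamma_nonneg p by simp
      moreover have "0 \<le> p * (a n - real m * (\<Gamma> * (1 - F n) - a n))"
        using closing_cost[of n] p by simp
      ultimately have "0 \<le> ?f v" by linarith
      then show ?thesis using False by simp
    qed
  qed
  also have "\<dots> = dual h + real m * gain h W"
    unfolding gain_def primal_def dual_def level_integral_def
    by (simp only: set_integral_add set_integral_diff set_integrable_mult_right
        set_integral_mult_right ints)
  finally show ?thesis .
qed

lemma primal_Nil: "primal [] = 0" and dual_Nil: "dual [] = 0"
  by (simp_all add: primal_def dual_def level_integral_def F_0 a_0)

end

section \<open>From consecutive sets to arbitrary intervals\<close>

lemma run_from_append:
  assumes "out \<in> set_pmf (run_from alg xs ys zs)"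
  shows "\<exists>t. out = ys @ t \<and> length t = length zs"
  using assms
proof (induction zs arbitrary: xs ys)
  case (Cons z zs)
  then obtain y where "out \<in> set_pmf (run_from alg (xs @ [z]) (ys @ [y]) zs)" by auto
  from Cons.IH[OF this] show ?case by auto
qed simp

lemma run_length:
  assumes "out \<in> set_pmf (run alg zs)"
  shows "length out = length zs"
  using run_from_append[OF assms[unfolded run_def]] by simp

text \<open>An empty multiset has no winner, hence \<open>m\<close> is positive. An element that is
  never offered surely never wins, so the bound F(0) for it is at least 1.\<close>

lemma F_discrete_OCS_imp_F_0:
  assumes "F_discrete_OCS {0, 1 :: nat} F m alg" and "F 0 \<le> 1"
  shows "0 < m" and "F 0 = 1"
proof -
  have dis: "discrete_OCS {0, 1} m alg" using assms(1) by (simp add: F_discrete_OCS_def)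
  show m: "0 < m"
  proof (rule ccontr)
    assume "\<not> 0 < m"
    then have inp: "OCS_input {0, 1} m [{#} :: nat multiset]" by (simp add: OCS_input_def)
    obtain out where "out \<in> set_pmf (run alg [{#}])" using set_pmf_not_empty by fast
    then show False using dis inp unfolding discrete_OCS_def by fastforce
  qed
  \<comment> \<open>Two steps, the shortest input that contains a \<open>consecutive\<close>
    set.\<close>
  define As where "As = [replicate_mset m (1 :: nat), replicate_mset m 1]"
  have inp: "OCS_input {0, 1} m As" using m by (simp add: OCS_input_def As_def)
  have "AE out in run alg As. \<forall>j\<in>{0..1}. out ! j \<noteq> 0"
  proof (rule AE_pmfI, intro ballI)
    fix out j assume "out \<in> set_pmf (run alg As)" "j \<in> {0..1 :: nat}"
    then have "out ! j \<in># As ! j"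
      using dis inp unfolding discrete_OCS_def by (auto simp: As_def)
    moreover have "As ! j = replicate_mset m 1"
      using \<open>j \<in> {0..1}\<close> by (cases j) (auto simp: As_def)
    ultimately show "out ! j \<noteq> 0" using m by simp
  qed
  then have "measure_pmf.prob (run alg As) {out. \<forall>j\<in>{0..1}. out ! j \<noteq> 0} = 1"
    using measure_pmf.prob_Collect_eq_1[of "run alg As"] by simp
  moreover have "measure_pmf.prob (run alg As) {out. \<forall>j\<in>{0..1}. out ! j \<noteq> 0} \<le> F (count_in As 0 {0..1})"
  proof -
    have bound: "measure_pmf.prob (run alg As) {out. \<forall>j\<in>(\<Union>l<k. S l). out ! j \<noteq> 0}
        \<le> (\<Prod>l<k. F (count_in As 0 (S l)))"
      if "\<forall>l<k. consecutive (S l) \<and> S l \<subseteq> {..<length As}" "disjoint_family_on S {..<k}"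
      for S and k :: nat
      using assms(1) inp that unfolding F_discrete_OCS_def by simp
    have "consecutive {0..1}" unfolding consecutive_def by (intro exI[of _ 0] exI[of _ 1]) simp
    moreover have "{0..1} \<subseteq> {..<length As}" by (auto simp: As_def)
    ultimately show ?thesis
      using bound[of "Suc 0" "\<lambda>_. {0..1}"] by (simp add: disjoint_family_on_def lessThan_Suc)
  qed
  moreover have "count_in As 0 {0..1} = 0"
    by (simp add: count_in_def As_def numeral_2_eq_2)
  ultimately show "F 0 = 1" using assms(2) by simp
qed

definition padded :: "('a \<Rightarrow> 'b) \<Rightarrow> 'b \<Rightarrow> 'a list \<Rightarrow> 'b list" where
  "padded f d xs = concat (map (\<lambda>x. [f x, d]) xs)"

lemma padded_simps [simp]:
  "padded f d [] = []" "padded f d (x # xs) = f x # d # padded f d xs"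
  "padded f d (xs @ ys) = padded f d xs @ padded f d ys"
  by (simp_all add: padded_def)

lemma length_padded [simp]: "length (padded f d xs) = 2 * length xs"
  by (induction xs) auto

lemma nth_padded:
  assumes "j < length xs"
  shows "padded f d xs ! (2 * j) = f (xs ! j)" "padded f d xs ! Suc (2 * j) = d"
  using assms
proof (induction xs arbitrary: j)
  case (Cons x xs)
  { case 1 then show ?case using Cons by (cases j) auto }
  { case 2 then show ?case using Cons by (cases j) auto }
qed simp_all

lemma sum_atLeastLessThan_double:
  fixes f :: "nat \<Rightarrow> 'a::comm_monoid_add"
  shows "sum f {2 * a..<2 * b} = (\<Sum>j\<in>{a..<b}. f (2 * j) + f (Suc (2 * j)))"
proof (induction b)
  case (Suc b)
  show ?case
  proof (cases "a \<le> b")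
    case True
    then have "{2 * a..<2 * Suc b} = insert (Suc (2 * b)) (insert (2 * b) {2 * a..<2 * b})"
      "{a..<Suc b} = insert b {a..<b}" by auto
    then show ?thesis using Suc by (simp add: add_ac)
  qed simp
qed simp

text \<open>The definition of \<open>consecutive\<close> excludes singletons. Following each step by a dummy step
  makes every nonempty interval admissible.\<close>

definition simulate ::
    "('b multiset, 'b) online_alg \<Rightarrow> ('a \<Rightarrow> 'b) \<Rightarrow> ('b \<Rightarrow> 'a) \<Rightarrow> 'b \<Rightarrow> nat
      \<Rightarrow> ('a multiset, 'a) online_alg" where
  "simulate ocs enc dec d m = (\<lambda>As ys A.
     map_pmf dec (ocs (padded (image_mset enc) (replicate_mset m d) As) (padded enc d ys)
       (image_mset enc A)))"

text \<open>Validity of the OCS forces the winner of each dummy step to be \<open>d\<close> and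
  every other winner to be an encoded element. The simulation therefore loses nothing by decoding
  winners and re-inserting the dummy outputs.\<close>

lemma run_from_simulate:
  fixes enc :: "'a \<Rightarrow> 'b"
  assumes dec: "\<And>x. x \<in> G \<Longrightarrow> dec (enc x) = x"
    and "\<And>A. A \<in> set zs \<Longrightarrow> set_mset A \<subseteq> G"
    and "length xs = length ys"
    and "\<And>out j. out \<in> set_pmf (run_from ocs (padded (image_mset enc) (replicate_mset m d) xs)
            (padded enc d ys) (padded (image_mset enc) (replicate_mset m d) zs))
          \<Longrightarrow> j < 2 * length (xs @ zs)
          \<Longrightarrow> out ! j \<in># padded (image_mset enc) (replicate_mset m d) (xs @ zs) ! j"
  shows "run_from ocs (padded (image_mset enc) (replicate_mset m d) xs)
            (padded enc d ys) (padded (image_mset enc) (replicate_mset m d) zs)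
       = map_pmf (padded enc d) (run_from (simulate ocs enc dec d m) xs ys zs)"
  using assms(2-)
proof (induction zs arbitrary: xs ys)
  case (Cons z zs)
  let ?I = "padded (image_mset enc) (replicate_mset m d)" and ?O = "padded enc d"
  let ?D = "replicate_mset m d"
  let ?p = "ocs (?I xs) (?O ys) (image_mset enc z)"
  let ?q = "\<lambda>y. ocs (?I xs @ [image_mset enc z]) (?O ys @ [y]) ?D"
  let ?r = "\<lambda>y y'. run_from ocs (?I (xs @ [z])) (?O ys @ [y, y']) (?I zs)"
  have unfold: "run_from ocs (?I xs) (?O ys) (?I (z # zs)) = bind_pmf ?p (\<lambda>y. bind_pmf (?q y) (?r y))"
    by simp
  have valid: "out ! j \<in># ?I (xs @ z # zs) ! j"
    if "y \<in> set_pmf ?p" "y' \<in> set_pmf (?q y)" "out \<in> set_pmf (?r y y')" "j < 2 * length (xs @ z # zs)"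
    for out y y' j
  proof (rule Cons.prems(3))
    show "out \<in> set_pmf (run_from ocs (?I xs) (?O ys) (?I (z # zs)))"
      unfolding unfold set_bind_pmf using that by blast
  qed (use that in simp)
  \<comment> \<open>Validity is only known for complete runs, so the two outputs are first extended
    to one.\<close>
  have yy': "y \<in># image_mset enc z \<and> y' = d" if y: "y \<in> set_pmf ?p" "y' \<in> set_pmf (?q y)" for y y'
  proof -
    obtain out where out: "out \<in> set_pmf (?r y y')" using set_pmf_not_empty by fast
    then obtain t where t: "out = ?O ys @ [y, y'] @ t" using run_from_append[OF out] by auto
    let ?n = "length xs"
    have "out ! (2 * ?n) \<in># ?I (xs @ z # zs) ! (2 * ?n)"
      "out ! Suc (2 * ?n) \<in># ?I (xs @ z # zs) ! Suc (2 * ?n)"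
      using valid[OF y out] by simp_all
    moreover have "out ! (2 * ?n) = y" "out ! Suc (2 * ?n) = y'"
      using Cons.prems(2) by (simp_all add: t nth_append)
    moreover have "?I (xs @ z # zs) ! (2 * ?n) = image_mset enc z"
      "?I (xs @ z # zs) ! Suc (2 * ?n) = ?D"
      by (subst nth_padded; simp)+
    ultimately show ?thesis by (simp split: if_splits)
  qed
  have "bind_pmf ?p (\<lambda>y. bind_pmf (?q y) (?r y)) =
      bind_pmf ?p (\<lambda>y. map_pmf ?O (run_from (simulate ocs enc dec d m) (xs @ [z]) (ys @ [dec y]) zs))"
  proof (rule bind_pmf_cong[OF refl])
    fix y assume y: "y \<in> set_pmf ?p"
    obtain y' where y': "y' \<in> set_pmf (?q y)" using set_pmf_not_empty by fast
    have "y \<in># image_mset enc z" using yy'[OF y y'] by simp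
    then obtain x where x: "x \<in># z" "y = enc x" by auto
    then have encdec: "enc (dec y) = y" using dec Cons.prems(1)[of z] by auto
    have "bind_pmf (?q y) (?r y) = bind_pmf (?q y) (\<lambda>_. ?r y d)"
      using yy'[OF y] by (intro bind_pmf_cong) auto
    also have "\<dots> = run_from ocs (?I (xs @ [z])) (?O (ys @ [dec y])) (?I zs)"
      by (simp add: encdec)
    also have "\<dots> = map_pmf ?O (run_from (simulate ocs enc dec d m) (xs @ [z]) (ys @ [dec y]) zs)"
    proof (rule Cons.IH)
      fix out j
      assume out: "out \<in> set_pmf (run_from ocs (?I (xs @ [z])) (?O (ys @ [dec y])) (?I zs))"
        and j: "j < 2 * length ((xs @ [z]) @ zs)"
      have "out \<in> set_pmf (?r y y')" using out yy'[OF y y'] by (simp add: encdec)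
      then show "out ! j \<in># ?I ((xs @ [z]) @ zs) ! j" using valid[OF y y', of out j] j by simp
    qed (use Cons.prems in auto)
    finally show "bind_pmf (?q y) (?r y) =
      map_pmf ?O (run_from (simulate ocs enc dec d m) (xs @ [z]) (ys @ [dec y]) zs)" .
  qed
  then show ?case
    unfolding unfold by (simp add: simulate_def map_bind_pmf bind_map_pmf)
qed simp

lemma count_image_mset_eq:
  assumes "\<And>y. f y = f x \<longleftrightarrow> y = x"
  shows "count (image_mset f A) (f x) = count A x"
  by (induction A) (auto simp: assms)

definition blocks_upto :: "nat \<Rightarrow> nat \<Rightarrow> (nat \<Rightarrow> nat set) \<Rightarrow> bool" where
  "blocks_upto t k S \<longleftrightarrow>
     (\<forall>l<k. \<exists>a b. a < b \<and> b \<le> t \<and> S l = {a..<b}) \<and> disjoint_family_on S {..<k}"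

definition interval_OCS ::
    "'v set \<Rightarrow> (nat \<Rightarrow> real) \<Rightarrow> nat \<Rightarrow> ('v option multiset, 'v option) online_alg \<Rightarrow> bool" where
  "interval_OCS L F m alg \<longleftrightarrow>
     (\<forall>As. OCS_input (insert None (Some ` L)) m As \<longrightarrow>
       (\<forall>out\<in>set_pmf (run alg As). \<forall>j<length As. out ! j \<in># As ! j) \<and>
       (\<forall>i\<in>L. \<forall>k S. blocks_upto (length As) k S \<longrightarrow>
         measure_pmf.prob (run alg As) {out. \<forall>j\<in>(\<Union>l<k. S l). out ! j \<noteq> Some i}
           \<le> (\<Prod>l<k. F (count_in As (Some i) (S l)))))"

lemma interval_OCS_exists:
  fixes L :: "'v set"
  assumes fin: "finite L" and m: "0 < m"
    and OCS: "\<And>G :: nat set. finite G \<Longrightarrow> \<exists>alg. F_discrete_OCS G F m alg"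
  shows "\<exists>alg. interval_OCS L F m alg"
proof -
  define G where "G = insert None (Some ` L)"
  have "finite G" using fin by (simp add: G_def)
  then obtain idx :: "'v option \<Rightarrow> nat" where inj: "inj_on idx G"
    using finite_imp_inj_to_nat_seg by blast
  \<comment> \<open>The value 0 outside \<open>G\<close> makes \<open>enc_eq\<close> hold for every
    \<open>y\<close>, not only for those in \<open>G\<close>.\<close>
  define enc where "enc x = (if x \<in> G then Suc (idx x) else 0)" for x
  have enc_eq: "enc y = enc x \<longleftrightarrow> y = x" if "x \<in> G" for x y
    using that inj_onD[OF inj] by (auto simp: enc_def)
  define dec where "dec = inv_into G enc"
  have "inj_on enc G" using enc_eq by (auto intro: inj_onI)
  then have dec: "dec (enc x) = x" if "x \<in> G" for x using that by (simp add: dec_def)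
  obtain ocs where ocs: "F_discrete_OCS (enc ` G) F m ocs"
    using OCS[of "enc ` G"] \<open>finite G\<close> by auto
  define d where "d = enc None"
  let ?I = "padded (image_mset enc) (replicate_mset m d)" and ?O = "padded enc d"
  define alg where "alg = simulate ocs enc dec d m"
  have inp: "OCS_input (enc ` G) m (?I As)" if "OCS_input G m As" for As
    using that by (induction As) (auto simp: OCS_input_def d_def G_def)
  have valid_ocs: "out ! j \<in># ?I As ! j"
    if "OCS_input G m As" "out \<in> set_pmf (run ocs (?I As))" "j < 2 * length As" for As out j
    using ocs inp[OF that(1)] that unfolding F_discrete_OCS_def discrete_OCS_def by simp
  have run_eq: "run ocs (?I As) = map_pmf ?O (run alg As)" if "OCS_input G m As" for As
    using run_from_simulate[of G dec enc As "[]" "[]" ocs m d] dec valid_ocs[OF that] that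
    by (auto simp: run_def alg_def OCS_input_def)
  have valid: "out ! j \<in># As ! j"
    if As: "OCS_input G m As" and out: "out \<in> set_pmf (run alg As)" and j: "j < length As"
    for As out j
  proof -
    have "?O out \<in> set_pmf (run ocs (?I As))" using out by (simp add: run_eq[OF As])
    then have "?O out ! (2 * j) \<in># ?I As ! (2 * j)" by (rule valid_ocs[OF As]) (use j in simp)
    then obtain x where x: "x \<in># As ! j" "enc (out ! j) = enc x"
      using j run_length[OF out] by (auto simp: nth_padded)
    moreover have "x \<in> G" using As j x(1) by (auto simp: OCS_input_def)
    ultimately show ?thesis using enc_eq by simp
  qed
  have bound: "measure_pmf.prob (run alg As) {out. \<forall>j\<in>(\<Union>l<k. S l). out ! j \<noteq> Some i}
      \<le> (\<Prod>l<k. F (count_in As (Some i) (S l)))"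
    if As: "OCS_input G m As" and i: "i \<in> L" and blocks: "blocks_upto (length As) k S"
    for As i k S
  proof -
    have S: "\<exists>a b. a < b \<and> b \<le> length As \<and> S l = {a..<b}" if "l < k" for l
      using blocks that by (simp add: blocks_upto_def)
    have disj: "disjoint_family_on S {..<k}" using blocks by (simp add: blocks_upto_def)
    have iG: "Some i \<in> G" using i by (simp add: G_def)
    then have not_d: "d \<noteq> enc (Some i)" using enc_eq[of "Some i" None] by (simp add: d_def)
    \<comment> \<open>A singleton becomes two steps. The added dummy steps change neither the count
      of \<open>Some i\<close> nor whether it wins.\<close>
    define S' where "S' l = {x. x div 2 \<in> S l}" for l
    have S'_eq: "S' l = {2 * a..<2 * b}" if "S l = {a..<b}" for l a b
      unfolding S'_def that by auto
    have cons: "consecutive (S' l) \<and> S' l \<subseteq> {..<length (?I As)}"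
      and count: "count_in (?I As) (enc (Some i)) (S' l) = count_in As (Some i) (S l)"
      if l: "l < k" for l
    proof -
      obtain a b where ab: "a < b" "b \<le> length As" "S l = {a..<b}" using S[OF l] by blast
      note S' = S'_eq[OF ab(3)]
      have "{2 * a..<2 * b} = {2 * a..2 * b - 1}" using ab by auto
      then show "consecutive (S' l) \<and> S' l \<subseteq> {..<length (?I As)}"
        unfolding consecutive_def S' using ab
        by (intro conjI exI[of _ "2 * a"] exI[of _ "2 * b - 1"]) auto
      show "count_in (?I As) (enc (Some i)) (S' l) = count_in As (Some i) (S l)"
        unfolding count_in_def S' sum_atLeastLessThan_double ab(3)
      proof (rule sum.cong[OF refl])
        fix j assume "j \<in> {a..<b}"
        then have "j < length As" using ab by simp
        then show "count (?I As ! (2 * j)) (enc (Some i)) + count (?I As ! Suc (2 * j)) (enc (Some i))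
            = count (As ! j) (Some i)"
          using not_d count_image_mset_eq[of enc "Some i", OF enc_eq[OF iG]]
          by (simp add: nth_padded)
      qed
    qed
    have disj': "disjoint_family_on S' {..<k}"
      unfolding disjoint_family_on_def
    proof (intro ballI impI)
      fix l l' assume l: "l \<in> {..<k}" "l' \<in> {..<k}" "l \<noteq> l'"
      then show "S' l \<inter> S' l' = {}"
        using disjoint_family_onD[OF disj l] by (auto simp: S'_def)
    qed
    have "measure_pmf.prob (run alg As) {out. \<forall>j\<in>(\<Union>l<k. S l). out ! j \<noteq> Some i}
        \<le> measure_pmf.prob (run alg As)
            (?O -` {out. \<forall>j\<in>(\<Union>l<k. S' l). out ! j \<noteq> enc (Some i)})"
    proof (rule measure_pmf.finite_measure_mono_AE)
      show "AE out in run alg As. out \<in> {out. \<forall>j\<in>(\<Union>l<k. S l). out ! j \<noteq> Some i} \<longrightarrow>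
          out \<in> ?O -` {out. \<forall>j\<in>(\<Union>l<k. S' l). out ! j \<noteq> enc (Some i)}"
      proof (rule AE_pmfI, intro impI)
        fix out
        assume out: "out \<in> set_pmf (run alg As)"
          and no: "out \<in> {out. \<forall>j\<in>(\<Union>l<k. S l). out ! j \<noteq> Some i}"
        have "?O out ! x \<noteq> enc (Some i)" if "l < k" "x \<in> S' l" for l x
        proof -
          let ?j = "x div 2"
          have j: "?j \<in> S l" using that by (simp add: S'_def)
          then have "?j < length out" using S[OF that(1)] run_length[OF out] by auto
          moreover have "out ! ?j \<noteq> Some i" using no that(1) j by blast
          moreover have "x = 2 * ?j \<or> x = Suc (2 * ?j)" by presburger
          ultimately show ?thesis
            using not_d enc_eq[OF iG] nth_padded[of ?j out enc d] by metis
        qed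
        then show "out \<in> ?O -` {out. \<forall>j\<in>(\<Union>l<k. S' l). out ! j \<noteq> enc (Some i)}"
          by blast
      qed
    qed simp
    also have "\<dots> = measure_pmf.prob (run ocs (?I As))
        {out. \<forall>j\<in>(\<Union>l<k. S' l). out ! j \<noteq> enc (Some i)}"
      by (simp add: run_eq[OF As])
    also have "\<dots> \<le> (\<Prod>l<k. F (count_in (?I As) (enc (Some i)) (S' l)))"
      using ocs inp[OF As] iG cons disj' unfolding F_discrete_OCS_def by blast
    also have "\<dots> = (\<Prod>l<k. F (count_in As (Some i) (S l)))"
      using count by (intro prod.cong) auto
    finally show ?thesis .
  qed
  show ?thesis
    unfolding interval_OCS_def G_def[symmetric] using valid bound by (intro exI[of _ alg]) blast
qed

section \<open>The greedy algorithm\<close>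

definition online_map :: "('x list \<Rightarrow> 'x \<Rightarrow> 'y) \<Rightarrow> 'x list \<Rightarrow> 'y list" where
  "online_map f xs = map (\<lambda>j. f (take j xs) (xs ! j)) [0..<length xs]"

lemma length_online_map [simp]: "length (online_map f xs) = length xs"
  by (simp add: online_map_def)

lemma nth_online_map:
  "j < length xs \<Longrightarrow> online_map f xs ! j = f (take j xs) (xs ! j)"
  by (simp add: online_map_def)

lemma online_map_snoc: "online_map f (xs @ [x]) = online_map f xs @ [f xs x]"
  by (rule nth_equalityI) (auto simp: nth_online_map nth_append less_Suc_eq)

text \<open>Deterministic preprocessing that sees only past and present inputs can be folded into
  the algorithm.\<close>

lemma run_online_map:
  "run (\<lambda>xs ys x. alg (online_map f xs) ys (f xs x)) zs = run alg (online_map f zs)"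
proof -
  have "run_from (\<lambda>xs ys x. alg (online_map f xs) ys (f xs x)) xs ys zs
      = run_from alg (online_map f xs) ys (drop (length xs) (online_map f (xs @ zs)))" for xs ys
  proof (induction zs arbitrary: xs ys)
    case (Cons z zs)
    have "drop (length xs) (online_map f (xs @ z # zs))
        = f xs z # drop (Suc (length xs)) (online_map f (xs @ z # zs))"
      by (subst Cons_nth_drop_Suc[symmetric]) (simp_all add: nth_online_map)
    then show ?case using Cons[of "xs @ [z]"] by (simp add: online_map_snoc)
  qed simp
  from this[of "[]" "[]"] show ?thesis by (simp add: run_def online_map_def)
qed

section \<open>Level states as blocks of arrivals\<close>

lemma blocks_upto_extend:
  fixes F :: "nat \<Rightarrow> real" and c :: "nat \<Rightarrow> nat"
  assumes F_0: "F 0 = 1" and S: "blocks_upto s k S" and "s \<le> t"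
  obtains k' S' where "blocks_upto t k' S'"
    and "(\<Union>l<k'. S' l) = (\<Union>l<k. S l) \<union> {s..<t}"
    and "(\<Prod>l<k'. F (sum c (S' l))) = (\<Prod>l<k. F (sum c (S l))) * F (sum c {s..<t})"
proof (cases "s < t")
  case False
  then show thesis using that[of k S] S \<open>s \<le> t\<close> F_0 by simp
next
  case True
  define S' where "S' = S(k := {s..<t})"
  have below: "S l \<subseteq> {..<s}" if l: "l < k" for l
  proof -
    obtain a b where "b \<le> s" "S l = {a..<b}" using S l unfolding blocks_upto_def by blast
    then show ?thesis by auto
  qed
  have "blocks_upto t (Suc k) S'"
    unfolding blocks_upto_def
  proof (intro conjI allI impI)
    fix l assume l: "l < Suc k"
    show "\<exists>a b. a < b \<and> b \<le> t \<and> S' l = {a..<b}"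
    proof (cases "l = k")
      case False
      then obtain a b where "a < b" "b \<le> s" "S l = {a..<b}"
        using S l unfolding blocks_upto_def by (metis less_antisym)
      then show ?thesis using False True
        by (intro exI[of _ a] exI[of _ b]) (simp add: S'_def)
    qed (use True in \<open>auto simp: S'_def\<close>)
  next
    have disj: "disjoint_family_on S {..<k}" using S by (simp add: blocks_upto_def)
    have new: "S l \<inter> {s..<t} = {}" if "l < k" for l using below[OF that] by auto
    show "disjoint_family_on S' {..<Suc k}"
      unfolding disjoint_family_on_def
    proof (intro ballI impI)
      fix l l' assume "l \<in> {..<Suc k}" "l' \<in> {..<Suc k}" "l \<noteq> l'"
      then show "S' l \<inter> S' l' = {}"
        using disjoint_family_onD[OF disj, of l l'] new[of l] new[of l']
        by (cases "l = k"; cases "l' = k") (auto simp: S'_def Int_commute)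
    qed
  qed
  moreover have "(\<Union>l<Suc k. S' l) = (\<Union>l<k. S l) \<union> {s..<t}"
    by (auto simp: S'_def lessThan_Suc split: if_splits)
  moreover have "(\<Prod>l<Suc k. F (sum c (S' l))) = (\<Prod>l<k. F (sum c (S l))) * F (sum c {s..<t})"
    by (simp add: S'_def)
  ultimately show thesis by (rule that)
qed

text \<open>For v > W only the first copy closes a block; every later copy multiplies by F(0) =
  1.\<close>

lemma level_state_replicate:
  assumes "F 0 = 1" "0 < c" "level_state F v h = (p, n)"
  shows "level_state F v (replicate c W @ h) = (if v \<le> W then (p, n + c) else (p * F n, 0))"
  using assms(2)
proof (induction c)
  case (Suc c)
  then show ?case using assms(1,3) by (cases "c = 0") auto
qed simp

text \<open>Arrivals with \<open>c j = 0\<close> may lie inside a block whatever their weight: they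
  do not change the state, add nothing to the count, and the vertex cannot win there.\<close>

lemma level_state_blocks:
  fixes F :: "nat \<Rightarrow> real" and c :: "nat \<Rightarrow> nat"
  assumes F_0: "F 0 = 1" and "hist 0 = []"
    and Suc: "\<And>t. t < N \<Longrightarrow> hist (Suc t) = replicate (c t) (W t) @ hist t"
  obtains k S where "blocks_upto N k S"
    and "\<And>j. j \<in> (\<Union>l<k. S l) \<Longrightarrow> v \<le> W j \<or> c j = 0"
    and "(case level_state F v (hist N) of (p, n) \<Rightarrow> p * F n) = (\<Prod>l<k. F (sum c (S l)))"
proof -
  \<comment> \<open>Here \<open>s\<close> is the start of the open block. A closing arrival
    \<open>t\<close> belongs to no block, so \<open>s\<close> then becomes
    \<open>Suc t\<close>.\<close>
  have "\<exists>k S s. s \<le> t \<and> blocks_upto s k S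
      \<and> (\<forall>j\<in>(\<Union>l<k. S l) \<union> {s..<t}. v \<le> W j \<or> c j = 0)
      \<and> level_state F v (hist t) = (\<Prod>l<k. F (sum c (S l)), sum c {s..<t})" if "t \<le> N" for t
    using that
  proof (induction t)
    case 0
    show ?case
      by (intro exI[of _ 0] exI[of _ "\<lambda>_. {}"]) (simp add: assms(2) blocks_upto_def disjoint_family_on_def)
  next
    case (Suc t)
    then obtain k S s where s: "s \<le> t" and S: "blocks_upto s k S"
      and ge: "\<forall>j\<in>(\<Union>l<k. S l) \<union> {s..<t}. v \<le> W j \<or> c j = 0"
      and st: "level_state F v (hist t) = (\<Prod>l<k. F (sum c (S l)), sum c {s..<t})" by auto
    have hist: "hist (Suc t) = replicate (c t) (W t) @ hist t" using assms(3) Suc.prems by simp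
    have ivl: "{s..<Suc t} = insert t {s..<t}" using s by auto
    show ?case
    proof (cases "c t = 0 \<or> v \<le> W t")
      case True
      have "level_state F v (hist (Suc t)) = (\<Prod>l<k. F (sum c (S l)), sum c {s..<Suc t})"
        unfolding hist using True level_state_replicate[of F, OF F_0 _ st, of "c t" "W t"] st s
        by (cases "c t = 0") auto
      moreover have "\<forall>j\<in>(\<Union>l<k. S l) \<union> {s..<Suc t}. v \<le> W j \<or> c j = 0"
        using ge True unfolding ivl by auto
      ultimately show ?thesis using s S by (intro exI[of _ k] exI[of _ S] exI[of _ s]) auto
    next
      case False
      obtain k' S' where S': "blocks_upto t k' S'"
        "(\<Union>l<k'. S' l) = (\<Union>l<k. S l) \<union> {s..<t}"
        "(\<Prod>l<k'. F (sum c (S' l))) = (\<Prod>l<k. F (sum c (S l))) * F (sum c {s..<t})"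
        by (rule blocks_upto_extend[of F, OF F_0 S s])
      have "blocks_upto (Suc t) k' S'" using S'(1) unfolding blocks_upto_def by (meson le_SucI)
      moreover have "level_state F v (hist (Suc t)) = (\<Prod>l<k'. F (sum c (S' l)), 0)"
        unfolding hist S'(3) using False level_state_replicate[of F, OF F_0 _ st, of "c t" "W t"] by simp
      ultimately show ?thesis
        using ge S'(2) by (intro exI[of _ k'] exI[of _ S'] exI[of _ "Suc t"]) auto
    qed
  qed
  from this[of N] obtain k S s where s: "s \<le> N" and S: "blocks_upto s k S"
    and ge: "\<forall>j\<in>(\<Union>l<k. S l) \<union> {s..<N}. v \<le> W j \<or> c j = 0"
    and st: "level_state F v (hist N) = (\<Prod>l<k. F (sum c (S l)), sum c {s..<N})" by auto
  obtain k' S' where "blocks_upto N k' S'"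
    "(\<Union>l<k'. S' l) = (\<Union>l<k. S l) \<union> {s..<N}"
    "(\<Prod>l<k'. F (sum c (S' l))) = (\<Prod>l<k. F (sum c (S l))) * F (sum c {s..<N})"
    by (rule blocks_upto_extend[of F, OF F_0 S s])
  then show thesis using that[of k' S'] ge st by auto
qed

text \<open>Layer cake again: the expectation of \<open>X\<close> is the integral of the tail
  probabilities. Finite support turns the exchange of integrals into linearity over a finite
  sum.\<close>

lemma level_integral_le_expectation:
  fixes X :: "'a \<Rightarrow> real"
  assumes "F 0 = 1" and \<Phi>: "\<Phi> (1, 0) = 0" and fin: "finite (set_pmf M)"
    and X: "\<And>x. x \<in> set_pmf M \<Longrightarrow> 0 \<le> X x"
    and le: "\<And>v. 0 < v \<Longrightarrow> \<Phi> (level_state F v h) \<le> measure_pmf.prob M {x. v \<le> X x}"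
  shows "level_integral F \<Phi> h \<le> measure_pmf.expectation M X"
proof -
  let ?f = "\<lambda>v. \<Sum>x\<in>set_pmf M. pmf M x * indicator {..X x} v"
  have int: "set_integrable lborel {0<..} ?f"
    unfolding set_integrable_def scaleR_sum_right
    by (rule Bochner_Integration.integrable_sum)
       (use set_integrable_below in \<open>simp add: set_integrable_def\<close>)
  have "level_integral F \<Phi> h \<le> (LINT v:{0<..}|lborel. ?f v)"
    unfolding level_integral_def
  proof (rule set_integral_mono[OF level_integrable[of F, OF assms(1), of \<Phi>, OF \<Phi>] int])
    fix v :: real assume "v \<in> {0<..}"
    have "measure_pmf.prob M {x. v \<le> X x} = measure_pmf.expectation M (indicator {x. v \<le> X x})"
      by simp
    also have "\<dots> = (\<Sum>x\<in>set_pmf M. pmf M x * indicator {x. v \<le> X x} x)"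
      by (subst integral_measure_pmf[OF fin]) auto
    also have "\<dots> = ?f v" by (intro sum.cong) (auto simp: indicator_def)
    finally show "\<Phi> (level_state F v h) \<le> ?f v" using le[of v] \<open>v \<in> {0<..}\<close> by simp
  qed
  also have "\<dots> = (\<Sum>x\<in>set_pmf M. LINT v:{0<..}|lborel. pmf M x * indicator {..X x} v)"
    unfolding set_lebesgue_integral_def scaleR_sum_right
    by (rule Bochner_Integration.integral_sum)
       (use set_integrable_below in \<open>simp add: set_integrable_def\<close>)
  also have "\<dots> = (\<Sum>x\<in>set_pmf M. pmf M x * X x)"
    using X by (intro sum.cong refl set_integral_below) auto
  also have "\<dots> = measure_pmf.expectation M X"
    by (subst integral_measure_pmf[OF fin]) auto
  finally show ?thesis .
qed

section \<open>Greedy requests and weak duality\<close>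

context block_potential
begin

text \<open>\<open>None\<close> fills a request when every offer would lose; its gain 0 guarantees
  that a best choice never lowers the surplus.\<close>

definition offer_gain :: "('v \<Rightarrow> real list) \<Rightarrow> ('v \<Rightarrow> real) \<Rightarrow> 'v option \<Rightarrow> real" where
  "offer_gain H w x = (case x of None \<Rightarrow> 0 | Some i \<Rightarrow> gain (H i) (w i))"

definition offer :: "('v \<Rightarrow> real list) \<Rightarrow> ('v \<Rightarrow> real) \<Rightarrow> 'v option \<Rightarrow> 'v \<Rightarrow> real list" where
  "offer H w x = (case x of None \<Rightarrow> H | Some i \<Rightarrow> H(i := w i # H i))"

definition best :: "'v set \<Rightarrow> ('v \<Rightarrow> real list) \<Rightarrow> ('v \<Rightarrow> real) \<Rightarrow> 'v option" where
  "best L H w = (SOME x. x \<in> insert None (Some ` L) \<and>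
     (\<forall>y\<in>insert None (Some ` L). offer_gain H w y \<le> offer_gain H w x))"

primrec greedy :: "'v set \<Rightarrow> ('v \<Rightarrow> real) \<Rightarrow> ('v \<Rightarrow> real list) \<Rightarrow> nat
    \<Rightarrow> 'v option multiset \<times> ('v \<Rightarrow> real list)" where
  "greedy L w H 0 = ({#}, H)"
| "greedy L w H (Suc k) =
     (case greedy L w H k of (A, H') \<Rightarrow> (add_mset (best L H' w) A, offer H' w (best L H' w)))"

definition history :: "'v set \<Rightarrow> ('v \<Rightarrow> real) list \<Rightarrow> 'v \<Rightarrow> real list" where
  "history L ws = fold (\<lambda>w H. snd (greedy L w H m)) ws (\<lambda>_. [])"

definition request :: "'v set \<Rightarrow> ('v \<Rightarrow> real) list \<Rightarrow> ('v \<Rightarrow> real) \<Rightarrow> 'v option multiset" where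
  "request L ws w = fst (greedy L w (history L ws) m)"

text \<open>Its increase during an arrival is the dual variable of that online vertex.\<close>

definition surplus :: "'v set \<Rightarrow> ('v \<Rightarrow> real list) \<Rightarrow> real" where
  "surplus L H = (\<Sum>i\<in>L. primal (H i) - dual (H i))"

context
  fixes L :: "'v set"
  assumes fin: "finite L"
begin

lemma best_in: "best L H w \<in> insert None (Some ` L)"
  and best_max: "y \<in> insert None (Some ` L) \<Longrightarrow> offer_gain H w y \<le> offer_gain H w (best L H w)"
proof -
  let ?G = "insert None (Some ` L)"
  have "finite (offer_gain H w ` ?G)" using fin by simp
  then have "Max (offer_gain H w ` ?G) \<in> offer_gain H w ` ?G"
    and max: "\<And>y. y \<in> ?G \<Longrightarrow> offer_gain H w y \<le> Max (offer_gain H w ` ?G)"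
    by (rule Max_in, blast) (simp add: \<open>finite (offer_gain H w ` ?G)\<close> del: image_insert)
  then obtain x where "x \<in> ?G" "Max (offer_gain H w ` ?G) = offer_gain H w x" by (elim imageE)
  then have "\<exists>x. x \<in> ?G \<and> (\<forall>y\<in>?G. offer_gain H w y \<le> offer_gain H w x)" using max by metis
  from someI_ex[OF this]
  show "best L H w \<in> ?G" "y \<in> ?G \<Longrightarrow> offer_gain H w y \<le> offer_gain H w (best L H w)"
    unfolding best_def by blast+
qed

lemma surplus_offer:
  assumes "x \<in> insert None (Some ` L)"
  shows "surplus L (offer H w x) = surplus L H + offer_gain H w x"
proof (cases x)
  case (Some i)
  then have i: "i \<in> L" using assms by auto
  have "surplus L (offer H w x) = (primal (w i # H i) - dual (w i # H i))
      + (\<Sum>j\<in>L - {i}. primal (H j) - dual (H j))"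
    unfolding surplus_def offer_def Some by (subst sum.remove[OF fin i]) simp
  then show ?thesis
    unfolding surplus_def by (subst sum.remove[OF fin i]) (simp add: Some offer_gain_def gain_def)
qed (simp add: offer_def offer_gain_def)

lemma dual_offer_mono: "dual (H i) \<le> dual (offer H w x i)"
  using dual_Cons_mono by (auto simp: offer_def split: option.splits)

lemma greedy_size: "size (fst (greedy L w H k)) = k"
  by (induction k) (auto split: prod.splits)

lemma greedy_subset: "set_mset (fst (greedy L w H k)) \<subseteq> insert None (Some ` L)"
  using best_in by (induction k) (auto split: prod.splits)

lemma greedy_history:
  "snd (greedy L w H k) i = replicate (count (fst (greedy L w H k)) (Some i)) (w i) @ H i"
  by (induction k) (auto simp: offer_def split: prod.splits option.splits)

text \<open>Each pick gains at least as much as offering to \<open>i\<close> at that moment, so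
  \<open>dual_gain_covers\<close> applies to it, and the dual of \<open>i\<close> may be replaced by
  its later, larger value. With k = m, dividing by \<open>m\<close> gives the constraint of the
  edge.\<close>

lemma greedy_covers:
  fixes w H k
  defines "H' \<equiv> snd (greedy L w H k)"
  assumes "i \<in> L" "0 \<le> w i"
  shows "dual (H i) \<le> dual (H' i)" and "surplus L H \<le> surplus L H'"
    and "real k * (\<Gamma> * w i) \<le> real k * dual (H' i) + real m * (surplus L H' - surplus L H)"
  unfolding H'_def
proof (induction k)
  case (Suc k)
  let ?K = "snd (greedy L w H k)" and ?K' = "snd (greedy L w H (Suc k))"
  let ?x = "best L ?K w"
  have K': "?K' = offer ?K w ?x" by (simp split: prod.splits)
  have sur: "surplus L ?K' = surplus L ?K + offer_gain ?K w ?x"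
    unfolding K' by (rule surplus_offer[OF best_in])
  have dual: "dual (?K i) \<le> dual (?K' i)" unfolding K' by (rule dual_offer_mono)
  { case 1 show ?case using Suc(1) dual by simp }
  { case 2 show ?case using Suc(2) sur best_max[of None ?K w] by (simp add: offer_gain_def) }
  { case 3
    have "real m * gain (?K i) (w i) \<le> real m * offer_gain ?K w ?x"
      using best_max[of "Some i" ?K w] assms(2) by (simp add: offer_gain_def mult_left_mono)
    with dual_gain_covers[OF assms(3), of "?K i"]
    have "\<Gamma> * w i \<le> dual (?K i) + real m * offer_gain ?K w ?x" by linarith
    moreover have "real (Suc k) * dual (?K i) \<le> real (Suc k) * dual (?K' i)"
      using dual by (intro mult_left_mono) auto
    ultimately show ?case using Suc(3) unfolding sur by (simp add: algebra_simps) }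
qed simp_all

lemma history_snoc: "history L (ws @ [w]) = snd (greedy L w (history L ws) m)"
  by (simp add: history_def)

lemma history_take_Suc:
  "j < length ws \<Longrightarrow>
    history L (take (Suc j) ws) = snd (greedy L (ws ! j) (history L (take j ws)) m)"
  by (simp add: take_Suc_conv_app_nth history_snoc)

lemma dual_history_mono:
  assumes "j \<le> length ws"
  shows "dual (history L (take j ws) i) \<le> dual (history L ws i)"
proof -
  have "dual (H i) \<le> dual (snd (greedy L w H k) i)" for w H k
  proof (induction k)
    case (Suc k)
    then show ?case
      using dual_offer_mono[of "snd (greedy L w H k)" i] by (auto split: prod.splits intro: order_trans)
  qed simp
  then have "dual (history L us i) \<le> dual (history L (us @ vs) i)" for us vs
  proof (induction vs rule: rev_induct)
    case (snoc v vs)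
    then show ?case
      using history_snoc[of "us @ vs" v] by (simp, meson order_trans)
  qed simp
  from this[of "take j ws" "drop j ws"] show ?thesis by simp
qed

lemma requests_OCS_input:
  "OCS_input (insert None (Some ` L)) m (online_map (request L) ws)"
  using greedy_size greedy_subset by (auto simp: OCS_input_def online_map_def request_def)

text \<open>Weak duality: the edge constraints are summed over an optimal matching, which uses each
  dual variable at most once. The online variables telescope to the final surplus, and adding the
  offline duals leaves the primal sum.\<close>

lemma primal_dual_bound:
  assumes inst: "matching_instance L ws"
  shows "\<Gamma> * opt_value L ws \<le> (\<Sum>i\<in>L. primal (history L ws i))"
proof -
  let ?V = "{(\<Sum>(i, j)\<in>M. (ws ! j) i) | M. is_matching L (length ws) M}"
  have "finite {M. is_matching L (length ws) M}"
    by (rule finite_subset[of _ "Pow (L \<times> {..<length ws})"]) (auto simp: is_matching_def fin)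
  then have "finite ?V" by simp
  moreover have "is_matching L (length ws) {}" by (simp add: is_matching_def)
  then have "?V \<noteq> {}" by blast
  ultimately have "opt_value L ws \<in> ?V" unfolding opt_value_def by (rule Max_in)
  then obtain M where opt: "opt_value L ws = (\<Sum>(i, j)\<in>M. (ws ! j) i)"
    and M: "M \<subseteq> L \<times> {..<length ws}" "inj_on fst M" "inj_on snd M"
    by (auto simp: is_matching_def)
  define s where "s j = surplus L (history L (take j ws))" for j
  have finM: "finite M" using finite_subset[OF M(1)] fin by simp
  have wt: "0 \<le> (ws ! j) i" if "i \<in> L" "j < length ws" for i j
    using inst that by (auto simp: matching_instance_def)
  have s_mono: "s j \<le> s (Suc j)" if "i \<in> L" "j < length ws" for i j
    unfolding s_def history_take_Suc[OF that(2)] by (rule greedy_covers(2)[where w = "ws ! j", OF that(1) wt[OF that]])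
  have cover: "\<Gamma> * (ws ! j) i \<le> dual (history L ws i) + (s (Suc j) - s j)"
    if "i \<in> L" "j < length ws" for i j
  proof -
    let ?d = "dual (history L (take (Suc j) ws) i)"
    have "real m * (\<Gamma> * (ws ! j) i) \<le> real m * ?d + real m * (s (Suc j) - s j)"
      unfolding s_def history_take_Suc[OF that(2)] by (rule greedy_covers(3)[where w = "ws ! j", OF that(1) wt[OF that]])
    then have "real m * (\<Gamma> * (ws ! j) i) \<le> real m * (?d + (s (Suc j) - s j))"
      by (simp add: algebra_simps)
    then have "\<Gamma> * (ws ! j) i \<le> ?d + (s (Suc j) - s j)" using m_pos by simp
    then show ?thesis using dual_history_mono[of "Suc j" ws i] that(2) by simp
  qed
  have "\<Gamma> * opt_value L ws = (\<Sum>x\<in>M. \<Gamma> * (ws ! snd x) (fst x))"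
    by (simp add: opt sum_distrib_left split_beta)
  also have "\<dots> \<le> (\<Sum>x\<in>M. dual (history L ws (fst x)) + (s (Suc (snd x)) - s (snd x)))"
    using M(1) by (intro sum_mono cover) auto
  also have "\<dots> = (\<Sum>i\<in>fst ` M. dual (history L ws i)) + (\<Sum>j\<in>snd ` M. s (Suc j) - s j)"
    by (simp only: sum.distrib sum.reindex[OF M(2)] sum.reindex[OF M(3)] o_def)
  also have "\<dots> \<le> (\<Sum>i\<in>L. dual (history L ws i)) + (\<Sum>j\<in>snd ` M. s (Suc j) - s j)"
    using M(1) fin dual_nonneg by (intro add_right_mono sum_mono2) auto
  also have "(\<Sum>j\<in>snd ` M. s (Suc j) - s j) \<le> s (length ws) - s 0"
  \<comment> \<open>\<open>s_mono\<close> needs some offline vertex; without one the matching is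
    empty.\<close>
  proof (cases "L = {}")
    case True
    then show ?thesis using M(1) by (simp add: s_def surplus_def)
  next
    case False
    then obtain i where i: "i \<in> L" by auto
    have "(\<Sum>j\<in>snd ` M. s (Suc j) - s j) \<le> (\<Sum>j<length ws. s (Suc j) - s j)"
      using M(1) s_mono[OF i] by (intro sum_mono2) auto
    then show ?thesis by (simp add: sum_lessThan_telescope)
  qed
  also have "s 0 = 0" by (simp add: s_def surplus_def history_def primal_Nil dual_Nil)
  also have "s (length ws) = (\<Sum>i\<in>L. primal (history L ws i)) - (\<Sum>i\<in>L. dual (history L ws i))"
    by (simp add: s_def surplus_def sum_subtractf)
  finally show ?thesis by simp
qed

text \<open>Requests depend on the weights but never on the winners. The OCS therefore runs on an
  input fixed by the instance, and all histories are deterministic.\<close>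

lemma matching_alg_exists:
  assumes OCS: "\<And>G :: nat set. finite G \<Longrightarrow> \<exists>alg. F_discrete_OCS G F m alg"
  shows "\<exists>alg. \<forall>ws. matching_instance L ws \<longrightarrow>
    (\<forall>out\<in>set_pmf (run alg ws). set out \<subseteq> insert None (Some ` L)) \<and>
    \<Gamma> * opt_value L ws \<le> measure_pmf.expectation (run alg ws) (free_disposal_value L ws)"
proof -
  let ?G = "insert None (Some ` L)"
  obtain alg where alg: "interval_OCS L F m alg" using interval_OCS_exists[OF fin m_pos OCS] by blast
  note valid = alg[unfolded interval_OCS_def, rule_format, THEN conjunct1, rule_format]
    and bound = alg[unfolded interval_OCS_def, rule_format, THEN conjunct2, rule_format]
  define malg where "malg = (\<lambda>ws ys w. alg (online_map (request L) ws) ys (request L ws w))"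
  have "(\<forall>out\<in>set_pmf (run malg ws). set out \<subseteq> ?G) \<and>
      \<Gamma> * opt_value L ws \<le> measure_pmf.expectation (run malg ws) (free_disposal_value L ws)"
    if inst: "matching_instance L ws" for ws
  proof -
    define As where "As = online_map (request L) ws"
    let ?M = "run alg As"
    have run_eq: "run malg ws = ?M" unfolding malg_def As_def by (rule run_online_map)
    have lenAs: "length As = length ws" by (simp add: As_def)
    have inp: "OCS_input ?G m As" unfolding As_def by (rule requests_OCS_input)
    have len: "length out = length ws" if "out \<in> set_pmf ?M" for out
      using run_length[OF that] lenAs by simp
    have sub: "set out \<subseteq> ?G" if out: "out \<in> set_pmf ?M" for out
    proof
      fix x assume "x \<in> set out"
      then obtain j where j: "j < length As" "x = out ! j"
        using len[OF out] lenAs by (auto simp: in_set_conv_nth)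
      then have "x \<in># As ! j" using valid[OF inp out] by simp
      moreover have "As ! j \<in> set As" using j(1) by simp
      ultimately show "x \<in> ?G" using inp unfolding OCS_input_def by blast
    qed
    have "set_pmf ?M \<subseteq> {out. set out \<subseteq> ?G \<and> length out = length ws}" using sub len by auto
    moreover have "finite {out. set out \<subseteq> ?G \<and> length out = length ws}"
      using fin by (intro finite_lists_length_eq) simp
    ultimately have finM: "finite (set_pmf ?M)" by (rule finite_subset)
    define X where "X i out = Max (insert 0 {(ws ! j) i | j. j < length ws \<and> out ! j = Some i})"
      for i and out :: "'v option list"
    have finX: "finite {(ws ! j) i | j. j < length ws \<and> out ! j = Some i}"
      for i and out :: "'v option list" by simp
    have primal_le: "primal (history L ws i) \<le> measure_pmf.expectation ?M (X i)" if i: "i \<in> L" for i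
      unfolding primal_def
    proof (rule level_integral_le_expectation[of F, OF F_0 _ finM])
      show "0 \<le> X i out" for out unfolding X_def by (rule Max_ge) (use finX in auto)
      fix v :: real assume "0 < v"
      let ?c = "\<lambda>j. count (As ! j) (Some i)"
      have hist: "history L (take (Suc t) ws) i
          = replicate (?c t) ((ws ! t) i) @ history L (take t ws) i" if "t < length ws" for t
        unfolding history_take_Suc[OF that] As_def nth_online_map[OF that] request_def
        by (rule greedy_history)
      obtain k S where S: "blocks_upto (length ws) k S"
        and ge: "\<And>j. j \<in> (\<Union>l<k. S l) \<Longrightarrow> v \<le> (ws ! j) i \<or> ?c j = 0"
        and st: "(case level_state F v (history L (take (length ws) ws) i) of (p, n) \<Rightarrow> p * F n)
            = (\<Prod>l<k. F (sum ?c (S l)))"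
        by (rule level_state_blocks[of F "\<lambda>t. history L (take t ws) i" "length ws" ?c
              "\<lambda>t. (ws ! t) i" v]) (use F_0 hist in \<open>auto simp: history_def\<close>)
      \<comment> \<open>A win of \<open>i\<close> inside the blocks means that \<open>i\<close> was
        requested there, so the weight is at least \<open>v\<close> and so is the contribution of
        \<open>i\<close>.\<close>
      have "measure_pmf.prob ?M {out. X i out < v}
          \<le> measure_pmf.prob ?M {out. \<forall>j\<in>(\<Union>l<k. S l). out ! j \<noteq> Some i}"
      proof (rule measure_pmf.finite_measure_mono_AE)
        show "AE out in ?M. out \<in> {out. X i out < v} \<longrightarrow>
            out \<in> {out. \<forall>j\<in>(\<Union>l<k. S l). out ! j \<noteq> Some i}"
        proof (rule AE_pmfI, intro impI CollectI ballI notI)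
          fix out j
          assume out: "out \<in> set_pmf ?M" and X: "out \<in> {out. X i out < v}"
            and j: "j \<in> (\<Union>l<k. S l)" and win: "out ! j = Some i"
          have jn: "j < length ws" using j S by (force simp: blocks_upto_def)
          then have "Some i \<in># As ! j" using valid[OF inp out, of j] win lenAs by simp
          then have "v \<le> (ws ! j) i" using ge[OF j] by (simp add: count_eq_zero_iff)
          also have "\<dots> \<le> X i out"
            unfolding X_def by (rule Max_ge) (use finX jn win in auto)
          finally show False using X by simp
        qed
      qed simp
      also have "\<dots> \<le> (\<Prod>l<k. F (count_in As (Some i) (S l)))"
        using bound[OF inp i] S lenAs by simp
      also have "\<dots> = (case level_state F v (history L ws i) of (p, n) \<Rightarrow> p * F n)"
        using st by (simp add: count_in_def)
      finally have "measure_pmf.prob ?M {out. X i out < v}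
        \<le> (case level_state F v (history L ws i) of (p, n) \<Rightarrow> p * F n)" .
      moreover have "measure_pmf.prob ?M {out. v \<le> X i out}
          = 1 - measure_pmf.prob ?M {out. X i out < v}"
        using measure_pmf.prob_compl[of "{out. X i out < v}" ?M]
        by (simp add: Compl_eq_Diff_UNIV[symmetric] Collect_neg_eq[symmetric] not_less)
      ultimately show "win_bound (level_state F v (history L ws i))
          \<le> measure_pmf.prob ?M {out. v \<le> X i out}"
        by (simp add: split_beta)
    qed (simp add: F_0)
    have "\<Gamma> * opt_value L ws \<le> (\<Sum>i\<in>L. primal (history L ws i))"
      by (rule primal_dual_bound[OF inst])
    also have "\<dots> \<le> (\<Sum>i\<in>L. measure_pmf.expectation ?M (X i))" by (intro sum_mono primal_le)
    also have "\<dots> = measure_pmf.expectation ?M (\<lambda>out. \<Sum>i\<in>L. X i out)"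
      by (rule Bochner_Integration.integral_sum[symmetric])
         (rule integrable_measure_pmf_finite[OF finM])
    also have "(\<lambda>out. \<Sum>i\<in>L. X i out) = free_disposal_value L ws"
      by (simp add: free_disposal_value_def X_def fun_eq_iff)
    finally show ?thesis using sub by (simp add: run_eq)
  qed
  then show ?thesis by blast
qed

end

end

theorem mainTheorem5:
  fixes m :: nat and F :: "nat \<Rightarrow> real" and \<Gamma> :: real
  assumes F_range: "\<And>k. F k \<in> {0..1}"
    and F_convex: "convex_seq F"
    and F_log_concave: "log_concave_seq F"
    and F_limit: "F \<longlonglongrightarrow> 0"
    and F_third: "\<And>k1 k2. (fdiff ^^ 3) F k1 * fdiff F k2 + fdiff F k1 * (fdiff ^^ 3) F k2
                    \<le> 2 * (fdiff ^^ 2) F k1 * (fdiff ^^ 2) F k2"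
    and Gamma_eq: "\<Gamma> = 1 - (\<Sum>n. real m ^ n / (real m + 1) ^ (n + 1) * F n)"
    and m_bound: "real m \<le> (- real m * fdiff F 0 - \<Gamma>) / (\<Gamma> + (1 - \<Gamma>) * real m * fdiff F 0)"
    and OCS: "\<And>G :: nat set. finite G \<Longrightarrow> \<exists>alg. F_discrete_OCS G F m alg"
  shows "\<exists>alg :: 'v matching_alg. valid_matching_alg alg \<and> competitive \<Gamma> alg"
proof -
  obtain alg01 where "F_discrete_OCS {0, 1 :: nat} F m alg01" using OCS[of "{0, 1}"] by auto
  then have m_pos: "0 < m" and F_0: "F 0 = 1"
    using F_discrete_OCS_imp_F_0 F_range[of 0] by auto
  have third: "(fdiff ^^ 3) F k * fdiff F k \<le> ((fdiff ^^ 2) F k)\<^sup>2" for k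
    using F_third[of k k] by (simp add: power2_eq_square mult.commute)
  obtain a where "block_potential F a m \<Gamma>"
    by (rule block_potential_exists
        [OF m_pos F_0 F_range F_convex F_log_concave F_limit third Gamma_eq m_bound])
  then interpret block_potential F a m \<Gamma> .
  define good :: "'v set \<Rightarrow> ('v \<Rightarrow> real, 'v option) online_alg \<Rightarrow> bool" where
    "good L alg \<longleftrightarrow> (\<forall>ws. matching_instance L ws \<longrightarrow>
      (\<forall>out\<in>set_pmf (run alg ws). set out \<subseteq> insert None (Some ` L)) \<and>
      \<Gamma> * opt_value L ws \<le> measure_pmf.expectation (run alg ws) (free_disposal_value L ws))" for L alg
  have "\<forall>L. \<exists>alg. finite L \<longrightarrow> good L alg"
    unfolding good_def using matching_alg_exists[OF _ OCS] by blast
  from choice[OF this] obtain alg where good: "\<And>L. finite L \<Longrightarrow> good L (alg L)" by blast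
  have "good L (alg L)" if "matching_instance L ws" for L ws
    using good that by (simp add: matching_instance_def)
  then have "valid_matching_alg alg \<and> competitive \<Gamma> alg"
    unfolding valid_matching_alg_def competitive_def good_def by blast
  then show ?thesis by blast
qed

end
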